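(* Let $ABCD$ be an isosceles tetrahedron in Euclidean 3-space and let $\ell$ be a bimedian of $ABCD$. Then the pairs of points that are isogonal conjugates with respect to $ABCD$ and are symmetric to each other with respect to the line $\ell$ form a hyperbolic paraboloid; that is, the set of all points $P$ such that $P$ and its reflection in the line $\ell$ are isogonal conjugates with respect to $ABCD$ is a hyperbolic paraboloid.
   Context: A (non-degenerate) tetrahedron $ABCD$ is called isosceles if its opposite edges are equal: $AB=CD$, $BC=AD$, $AC=BD$. A bimedian of a tetrahedron is the line joining the midpoints of two opposite edges. Symmetry with respect to a line is the rotation by $180^\circ$ about it. Isogonal conjugation: for the dihedral angle of the tetrahedron at an edge with edgeline $e$ and a point $P$, let $Pe$ be the plane through $P$ and $e$; its isogonal plane is the reflection of $Pe$ in the bisector plane of the dihedral angle. If $P$ lies on $e$, then the plane $Pe$, as well as its isogonal, may be taken to be any plane through $e$ (so the condition at $e$ is then vacuous). Points $P$ and $Q$ are isogonal conjugates with respect to the tetrahedron if for each of its six dihedral angles they lie in mutually isogonal planes through the corresponding edgeline (the condition at an edgeline $e$ being vacuous if $P$ or $Q$ lies on $e$). This relation is symmetric, and $P=Q$ is allowed. *)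

theory Defs
  imports "HOL-Analysis.Analysis"
begin

text \<open>For a closed affine subspace S the point closest to x is the foot of the perpendicular
  from x to S. Hence \<open>reflect_in S\<close> is the mirror reflection if S is a plane of 3-space, and the
  rotation by 180 degrees about S if S is a line of 3-space.\<close>

definition reflect_in :: "(real^3) set \<Rightarrow> real^3 \<Rightarrow> real^3" where
  "reflect_in S x = 2 *\<^sub>R closest_point S x - x"

definition line_through :: "real^3 \<Rightarrow> real^3 \<Rightarrow> (real^3) set" where
  "line_through A B = affine hull {A, B}"

definition plane_through :: "real^3 \<Rightarrow> real^3 \<Rightarrow> real^3 \<Rightarrow> (real^3) set" where
  "plane_through A B P = affine hull {A, B, P}"

definition tetrahedron :: "real^3 \<Rightarrow> real^3 \<Rightarrow> real^3 \<Rightarrow> real^3 \<Rightarrow> bool" where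
  "tetrahedron A B C D \<longleftrightarrow> \<not> coplanar {A, B, C, D}"

definition isosceles_tetrahedron :: "real^3 \<Rightarrow> real^3 \<Rightarrow> real^3 \<Rightarrow> real^3 \<Rightarrow> bool" where
  "isosceles_tetrahedron A B C D \<longleftrightarrow>
     tetrahedron A B C D \<and> dist A B = dist C D \<and> dist B C = dist A D \<and> dist A C = dist B D"

definition bimedians :: "real^3 \<Rightarrow> real^3 \<Rightarrow> real^3 \<Rightarrow> real^3 \<Rightarrow> (real^3) set set" where
  "bimedians A B C D =
     {line_through (midpoint A B) (midpoint C D),
      line_through (midpoint A C) (midpoint B D),
      line_through (midpoint A D) (midpoint B C)}"

text \<open>The unit vector orthogonal to the line AB that points from this line into the
  half-plane bounded by AB and containing C.\<close>

definition face_direction :: "real^3 \<Rightarrow> real^3 \<Rightarrow> real^3 \<Rightarrow> real^3" where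
  "face_direction A B C = sgn (C - closest_point (line_through A B) C)"

text \<open>The bisector plane of the dihedral angle at the edge AB between the faces ABC and ABD.
  The angle between the two face directions is the plane angle of the dihedral angle; as both
  are unit vectors, their sum spans its (interior) bisector.\<close>

definition bisector_plane :: "real^3 \<Rightarrow> real^3 \<Rightarrow> real^3 \<Rightarrow> real^3 \<Rightarrow> (real^3) set" where
  "bisector_plane A B C D =
     plane_through A B (A + face_direction A B C + face_direction A B D)"

text \<open>The condition on P and Q at the dihedral angle with edge AB and faces ABC, ABD.\<close>

definition isogonal_at ::
  "real^3 \<Rightarrow> real^3 \<Rightarrow> real^3 \<Rightarrow> real^3 \<Rightarrow> real^3 \<Rightarrow> real^3 \<Rightarrow> bool" where
  "isogonal_at A B C D P Q \<longleftrightarrow>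
     P \<in> line_through A B \<or> Q \<in> line_through A B \<or>
     reflect_in (bisector_plane A B C D) ` plane_through A B P = plane_through A B Q"

definition isogonal_conjugates ::
  "real^3 \<Rightarrow> real^3 \<Rightarrow> real^3 \<Rightarrow> real^3 \<Rightarrow> real^3 \<Rightarrow> real^3 \<Rightarrow> bool" where
  "isogonal_conjugates A B C D P Q \<longleftrightarrow>
     isogonal_at A B C D P Q \<and> isogonal_at A C B D P Q \<and> isogonal_at A D B C P Q \<and>
     isogonal_at B C A D P Q \<and> isogonal_at B D A C P Q \<and> isogonal_at C D A B P Q"

text \<open>Congruent (by the isometry \<open>v \<mapsto> c + f v\<close>) to a paraboloid
  \<open>z = x\<^sup>2 / p\<^sup>2 - y\<^sup>2 / q\<^sup>2\<close> in standard position.\<close>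

definition hyperbolic_paraboloid :: "(real^3) set \<Rightarrow> bool" where
  "hyperbolic_paraboloid S \<longleftrightarrow>
     (\<exists>(c::real^3) (f::real^3 \<Rightarrow> real^3) (p::real) (q::real). orthogonal_transformation f \<and> p > 0 \<and> q > 0 \<and>
        S = (\<lambda>v. c + f v) ` {v. v$3 = (v$1)\<^sup>2 / p\<^sup>2 - (v$2)\<^sup>2 / q\<^sup>2})"

end

theory Submission
  imports Defs
begin

text \<open>
  An isosceles tetrahedron is inscribed in a box: if \<open>O\<close> is its centroid and \<open>u\<close>, \<open>v\<close>, \<open>w\<close>
  are the halves of its bimedians, then \<open>u\<close>, \<open>v\<close>, \<open>w\<close> are pairwise orthogonal and the vertices
  are \<open>O + u + v + w\<close>, \<open>O + u - v - w\<close>, \<open>O - u + v - w\<close>, \<open>O - u - v + w\<close>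
  (\<open>isosceles_tetrahedron_in_box\<close>).  All points are written as \<open>O + x u + y v + z w\<close>, and a
  half-turn about a bimedian changes the sign of two of the coordinates \<open>x\<close>, \<open>y\<close>, \<open>z\<close>.

  In the isosceles case the bisector plane at the edge \<open>AB\<close> is spanned by \<open>AB\<close> and \<open>u\<close>: the
  two faces at \<open>AB\<close> have equal heights over \<open>AB\<close>, so the sum of their directions is parallel to
  the bimedian.  A plane through \<open>AB\<close> is determined by the ratio \<open>(1 - x) : (y - z)\<close> on it, and
  reflection in the bisector plane changes the sign of this ratio.  So \<open>(x, y, z)\<close> and
  \<open>(x', y', z')\<close> are isogonal at \<open>AB\<close> iff \<open>(1 - x) (y' - z') + (1 - x') (y - z) = 0\<close>
  (\<open>isogonal_at_box_iff\<close>); if one of the points lies on \<open>AB\<close>, both sides of this equivalence hold.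
  The other five edges arise by permuting the axes and changing signs.

  For \<open>(x', y', z') = (x, -y, -z)\<close> the equations at \<open>AB\<close> and \<open>CD\<close> are identities and the
  remaining four all reduce to \<open>x = y z\<close>.  This is a hyperbolic paraboloid because \<open>y z\<close> is a
  difference of two squares in the axes that bisect those of \<open>v\<close> and \<open>w\<close>.
\<close>

section \<open>Orthogonal frames\<close>

definition orthogonal_frame :: "real^3 \<Rightarrow> real^3 \<Rightarrow> real^3 \<Rightarrow> bool" where
  "orthogonal_frame u v w \<longleftrightarrow>
     u \<noteq> 0 \<and> v \<noteq> 0 \<and> w \<noteq> 0 \<and> u \<bullet> v = 0 \<and> u \<bullet> w = 0 \<and> v \<bullet> w = 0"

lemma orthogonal_frame_swap12: "orthogonal_frame u v w \<Longrightarrow> orthogonal_frame v u w"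
  and orthogonal_frame_rotate: "orthogonal_frame u v w \<Longrightarrow> orthogonal_frame w u v"
  and orthogonal_frame_minus13: "orthogonal_frame u v w \<Longrightarrow> orthogonal_frame (- u) v (- w)"
  by (auto simp: orthogonal_frame_def inner_commute)

lemma orthogonal_frame_span:
  assumes "orthogonal_frame u v w"
  obtains x y z where "P = x *\<^sub>R u + y *\<^sub>R v + z *\<^sub>R w"
proof -
  have nz: "u \<noteq> 0" "v \<noteq> 0" "w \<noteq> 0" "u \<bullet> v = 0" "u \<bullet> w = 0" "v \<bullet> w = 0"
    using assms by (auto simp: orthogonal_frame_def)
  then have "u \<noteq> v" "u \<noteq> w" "v \<noteq> w" by auto
  then have card: "card {u, v, w} = DIM(real^3)" by simp
  have "pairwise orthogonal {u, v, w}"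
    using nz by (auto simp: pairwise_def orthogonal_def inner_commute)
  then have "independent {u, v, w}"
    using nz by (intro pairwise_orthogonal_independent) auto
  then have "UNIV \<subseteq> span {u, v, w}"
    using card by (intro card_ge_dim_independent) auto
  then have "P \<in> span {u, v, w}" by auto
  then obtain x y z where "P - x *\<^sub>R u - y *\<^sub>R v = z *\<^sub>R w"
    by (auto simp: span_breakdown_eq span_singleton)
  then have "P = x *\<^sub>R u + y *\<^sub>R v + z *\<^sub>R w" by (simp add: algebra_simps)
  then show thesis by (rule that)
qed

lemma orthogonal_frame_coordinates_eq:
  assumes fr: "orthogonal_frame u v w"
    and eq: "x *\<^sub>R u + y *\<^sub>R v + z *\<^sub>R w = x' *\<^sub>R u + y' *\<^sub>R v + z' *\<^sub>R w"
  shows "x = x' \<and> y = y' \<and> z = z'"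
proof -
  have nz: "u \<noteq> 0" "v \<noteq> 0" "w \<noteq> 0" "u \<bullet> v = 0" "u \<bullet> w = 0" "v \<bullet> w = 0"
    using fr by (auto simp: orthogonal_frame_def)
  have "(x *\<^sub>R u + y *\<^sub>R v + z *\<^sub>R w) \<bullet> q = (x' *\<^sub>R u + y' *\<^sub>R v + z' *\<^sub>R w) \<bullet> q" for q
    using eq by simp
  from this[of u] this[of v] this[of w] show ?thesis
    using nz by (simp add: inner_add inner_commute)
qed

section \<open>The box of an isosceles tetrahedron\<close>

text \<open>Equality of opposite edges is orthogonality of the bimedians, because, for example,
  \<open>AB\<close> and \<open>CD\<close> are the vectors \<open>2 (v + w)\<close> and \<open>2 (v - w)\<close> up to sign, and these are the
  diagonals of a rectangle iff they have equal lengths.  If one of the bimedians vanished, two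
  opposite edges would bisect each other and the vertices would be coplanar.\<close>

lemma isosceles_tetrahedron_in_box:
  assumes "isosceles_tetrahedron A B C D"
  obtains O' u v w where "orthogonal_frame u v w"
    "A = O' + u + v + w" "B = O' + u - v - w" "C = O' - u + v - w" "D = O' - u - v + w"
proof -
  define O' where "O' = (1/4) *\<^sub>R (A + B + C + D)"
  define u where "u = (1/4) *\<^sub>R (A + B - C - D)"
  define v where "v = (1/4) *\<^sub>R (A + C - B - D)"
  define w where "w = (1/4) *\<^sub>R (A + D - B - C)"
  have verts: "A = O' + u + v + w" "B = O' + u - v - w" "C = O' - u + v - w" "D = O' - u - v + w"
    by (simp_all add: O'_def u_def v_def w_def vec_eq_iff field_simps)
  have noncop: "\<not> coplanar {A, B, C, D}"
    and edges: "dist A B = dist C D" "dist B C = dist A D" "dist A C = dist B D"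
    using assms by (auto simp: isosceles_tetrahedron_def tetrahedron_def)
  have "D \<notin> affine hull {A, B, C}"
  proof
    assume "D \<in> affine hull {A, B, C}"
    then have "{A, B, C, D} \<subseteq> affine hull {A, B, C}" by (auto simp: hull_inc)
    then show False using noncop unfolding coplanar_def by blast
  qed
  then have D: "D \<noteq> a *\<^sub>R A + b *\<^sub>R B + c *\<^sub>R C" if "a + b + c = 1" for a b c
    using that unfolding affine_hull_3 by blast
  have "u \<noteq> 0"
  proof -
    have "A + B - C - D \<noteq> 0" using D[of 1 1 "-1"] by (auto simp: algebra_simps)
    then show ?thesis unfolding u_def by simp
  qed
  moreover have "v \<noteq> 0"
  proof -
    have "A + C - B - D \<noteq> 0" using D[of 1 "-1" 1] by (auto simp: algebra_simps)
    then show ?thesis unfolding v_def by simp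
  qed
  moreover have "w \<noteq> 0"
  proof -
    have "A + D - B - C \<noteq> 0" using D[of "-1" 1 1] by (auto simp: algebra_simps)
    then show ?thesis unfolding w_def by simp
  qed
  moreover have parallelogram: "p \<bullet> q = 0" if "dist (X + p + q) (X - p - q) = dist (Y + p - q) (Y - p + q)"
    for p q X Y :: "real^3"
  proof -
    have "norm (2 *\<^sub>R (p + q)) = norm (2 *\<^sub>R (p - q))"
      using that by (simp add: dist_norm algebra_simps scaleR_2)
    then have "norm (p + q) = norm (p - q)" by simp
    then show ?thesis unfolding norm_eq by (simp add: inner_add inner_diff inner_commute)
  qed
  have "v \<bullet> w = 0"
    by (rule parallelogram[of "O' + u" v w "O' - u"]) (use edges(1) verts in \<open>simp add: algebra_simps\<close>)
  moreover have "u \<bullet> w = 0"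
    by (rule parallelogram[of "O' + v" u w "O' - v"])
      (use edges(3) verts in \<open>simp add: algebra_simps dist_commute\<close>)
  moreover have "u \<bullet> v = 0"
    by (rule parallelogram[of "O' + w" u v "O' - w"])
      (use edges(2) verts in \<open>simp add: algebra_simps dist_commute\<close>)
  ultimately have "orthogonal_frame u v w" by (simp add: orthogonal_frame_def)
  from that[OF this verts] show thesis .
qed

section \<open>The hyperbolic paraboloid\<close>

lemma orthogonal_transformation_orthonormal:
  fixes a b c :: "real^3"
  assumes "a \<bullet> a = 1" "b \<bullet> b = 1" "c \<bullet> c = 1" "a \<bullet> b = 0" "a \<bullet> c = 0" "b \<bullet> c = 0"
  shows "orthogonal_transformation (\<lambda>x::real^3. x$1 *\<^sub>R a + x$2 *\<^sub>R b + x$3 *\<^sub>R c)"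
proof -
  have "linear (\<lambda>x::real^3. x$1 *\<^sub>R a + x$2 *\<^sub>R b + x$3 *\<^sub>R c)"
    by (rule linearI) (simp_all add: algebra_simps)
  moreover have "(x$1 *\<^sub>R a + x$2 *\<^sub>R b + x$3 *\<^sub>R c) \<bullet> (y$1 *\<^sub>R a + y$2 *\<^sub>R b + y$3 *\<^sub>R c)
      = x$1 * y$1 + x$2 * y$2 + x$3 * y$3" for x y :: "real^3"
    using assms by (simp add: inner_add inner_commute)
  ultimately show ?thesis
    by (simp add: orthogonal_transformation_def inner_vec_def sum_3)
qed

text \<open>In Cartesian coordinates \<open>Y\<close>, \<open>Z\<close> along \<open>v\<close>, \<open>w\<close> the surface has the height \<open>k Y Z\<close> along
  \<open>u\<close>, where \<open>k = |u| / (|v| |w|)\<close>; turning these axes by 45 degrees makes the height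
  \<open>(k / 2) (r\<^sup>2 - s\<^sup>2)\<close>.\<close>

lemma hyperbolic_paraboloid_product:
  fixes O' u v w :: "real^3"
  assumes fr: "orthogonal_frame u v w"
  shows "hyperbolic_paraboloid {O' + (y * z) *\<^sub>R u + y *\<^sub>R v + z *\<^sub>R w | y z. True}"
proof -
  have nz: "u \<noteq> 0" "v \<noteq> 0" "w \<noteq> 0" and orth: "u \<bullet> v = 0" "u \<bullet> w = 0" "v \<bullet> w = 0"
    using fr by (auto simp: orthogonal_frame_def)
  define k where "k = norm u / (norm v * norm w)"
  have k: "k > 0" using nz by (simp add: k_def)
  define p where "p = sqrt (2 / k)"
  have p: "p > 0" "p\<^sup>2 = 2 / k" using k by (simp_all add: p_def)
  have unit: "sgn u \<bullet> sgn u = 1" "sgn v \<bullet> sgn v = 1" "sgn w \<bullet> sgn w = 1"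
    using nz by (simp_all add: norm_sgn flip: power2_norm_eq_inner)
  have sorth: "sgn u \<bullet> sgn v = 0" "sgn u \<bullet> sgn w = 0" "sgn v \<bullet> sgn w = 0"
    using orth by (simp_all add: sgn_div_norm)
  define a where "a = (1 / sqrt 2) *\<^sub>R (sgn v + sgn w)"
  define b where "b = (1 / sqrt 2) *\<^sub>R (sgn v - sgn w)"
  define f where "f = (\<lambda>x::real^3. x$1 *\<^sub>R a + x$2 *\<^sub>R b + x$3 *\<^sub>R sgn u)"
  have f: "orthogonal_transformation f"
    unfolding f_def
    by (rule orthogonal_transformation_orthonormal)
      (use unit sorth in \<open>simp_all add: a_def b_def inner_add inner_diff inner_commute\<close>)
  have vs: "v = norm v *\<^sub>R sgn v" "w = norm w *\<^sub>R sgn w" "u = norm u *\<^sub>R sgn u"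
    using nz by (simp_all add: sgn_div_norm)
  have point: "O' + f x = O' + (y * z) *\<^sub>R u + y *\<^sub>R v + z *\<^sub>R w"
    if "x$1 = (y * norm v + z * norm w) / sqrt 2" "x$2 = (y * norm v - z * norm w) / sqrt 2"
      "x$3 = y * z * norm u" for x y z
  proof -
    have "f x = (x$1 / sqrt 2 + x$2 / sqrt 2) *\<^sub>R sgn v + (x$1 / sqrt 2 - x$2 / sqrt 2) *\<^sub>R sgn w
        + x$3 *\<^sub>R sgn u"
      by (simp add: f_def a_def b_def algebra_simps)
    also have "x$1 / sqrt 2 + x$2 / sqrt 2 = y * norm v" using that by (simp add: field_simps)
    also have "x$1 / sqrt 2 - x$2 / sqrt 2 = z * norm w" using that by (simp add: field_simps)
    finally have "f x = (y * norm v) *\<^sub>R sgn v + (z * norm w) *\<^sub>R sgn w + (y * z * norm u) *\<^sub>R sgn u"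
      using that by simp
    also have "\<dots> = y *\<^sub>R (norm v *\<^sub>R sgn v) + z *\<^sub>R (norm w *\<^sub>R sgn w)
        + (y * z) *\<^sub>R (norm u *\<^sub>R sgn u)" by simp
    also have "\<dots> = y *\<^sub>R v + z *\<^sub>R w + (y * z) *\<^sub>R u"
      using vs by simp
    finally show ?thesis by simp
  qed
  have height: "r\<^sup>2 / p\<^sup>2 - s\<^sup>2 / p\<^sup>2 = y * z * norm u"
    if "r = (y * norm v + z * norm w) / sqrt 2" "s = (y * norm v - z * norm w) / sqrt 2" for r s y z
  proof -
    have "r\<^sup>2 - s\<^sup>2 = 2 * (y * norm v) * (z * norm w)"
      unfolding that by (simp add: power_divide power2_eq_square field_simps)
    then have "(r\<^sup>2 - s\<^sup>2) / p\<^sup>2 = (y * norm v) * (z * norm w) * k"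
      unfolding p(2) by simp
    then have "r\<^sup>2 / p\<^sup>2 - s\<^sup>2 / p\<^sup>2 = (y * norm v) * (z * norm w) * k"
      by (simp only: diff_divide_distrib)
    also have "\<dots> = y * z * norm u" using nz by (simp add: k_def)
    finally show ?thesis .
  qed
  have "{O' + (y * z) *\<^sub>R u + y *\<^sub>R v + z *\<^sub>R w | y z. True}
      = (\<lambda>x. O' + f x) ` {x. x$3 = (x$1)\<^sup>2 / p\<^sup>2 - (x$2)\<^sup>2 / p\<^sup>2}"
  proof (intro set_eqI iffI)
    fix X assume "X \<in> {O' + (y * z) *\<^sub>R u + y *\<^sub>R v + z *\<^sub>R w | y z. True}"
    then obtain y z where X: "X = O' + (y * z) *\<^sub>R u + y *\<^sub>R v + z *\<^sub>R w" by blast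
    define x :: "real^3" where
      "x = vector [(y * norm v + z * norm w) / sqrt 2, (y * norm v - z * norm w) / sqrt 2,
                   y * z * norm u]"
    have x: "x$1 = (y * norm v + z * norm w) / sqrt 2" "x$2 = (y * norm v - z * norm w) / sqrt 2"
      "x$3 = y * z * norm u" by (simp_all add: x_def)
    have "X = O' + f x" using X point[OF x] by simp
    moreover have "x$3 = (x$1)\<^sup>2 / p\<^sup>2 - (x$2)\<^sup>2 / p\<^sup>2" using height[OF x(1,2)] x(3) by simp
    ultimately show "X \<in> (\<lambda>x. O' + f x) ` {x. x$3 = (x$1)\<^sup>2 / p\<^sup>2 - (x$2)\<^sup>2 / p\<^sup>2}" by blast
  next
    fix X assume "X \<in> (\<lambda>x. O' + f x) ` {x. x$3 = (x$1)\<^sup>2 / p\<^sup>2 - (x$2)\<^sup>2 / p\<^sup>2}"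
    then obtain x where X: "X = O' + f x" and x3: "x$3 = (x$1)\<^sup>2 / p\<^sup>2 - (x$2)\<^sup>2 / p\<^sup>2" by blast
    define y where "y = (x$1 + x$2) / (sqrt 2 * norm v)"
    define z where "z = (x$1 - x$2) / (sqrt 2 * norm w)"
    have yz: "y * norm v = (x$1 + x$2) / sqrt 2" "z * norm w = (x$1 - x$2) / sqrt 2"
      using nz by (simp_all add: y_def z_def)
    have x12: "x$1 = (y * norm v + z * norm w) / sqrt 2" "x$2 = (y * norm v - z * norm w) / sqrt 2"
      unfolding yz by (simp_all add: field_simps)
    have "X = O' + (y * z) *\<^sub>R u + y *\<^sub>R v + z *\<^sub>R w"
      unfolding X using x3 height[OF x12] by (intro point[OF x12]) simp
    then show "X \<in> {O' + (y * z) *\<^sub>R u + y *\<^sub>R v + z *\<^sub>R w | y z. True}" by blast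
  qed
  then show ?thesis
    unfolding hyperbolic_paraboloid_def using f p(1) by blast
qed

lemma hyperbolic_paraboloid_coordinatesI:
  fixes O' u v w :: "real^3"
  assumes fr: "orthogonal_frame u v w"
    and S: "\<And>x y z. O' + x *\<^sub>R u + y *\<^sub>R v + z *\<^sub>R w \<in> S \<longleftrightarrow> x = y * z"
  shows "hyperbolic_paraboloid S"
proof -
  have "S = {O' + (y * z) *\<^sub>R u + y *\<^sub>R v + z *\<^sub>R w | y z. True}"
  proof (intro set_eqI iffI)
    fix P assume P: "P \<in> S"
    obtain x y z where "P - O' = x *\<^sub>R u + y *\<^sub>R v + z *\<^sub>R w"
      using orthogonal_frame_span[OF fr] .
    then have "P = O' + x *\<^sub>R u + y *\<^sub>R v + z *\<^sub>R w" by (simp add: algebra_simps)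
    moreover from this have "x = y * z" using P S by simp
    ultimately show "P \<in> {O' + (y * z) *\<^sub>R u + y *\<^sub>R v + z *\<^sub>R w | y z. True}" by blast
  qed (use S in blast)
  then show ?thesis using hyperbolic_paraboloid_product[OF fr] by simp
qed

section \<open>Lines, planes and reflections\<close>

text \<open>By the theorem of Pythagoras the foot of a perpendicular is the unique nearest point.\<close>

lemma closest_point_eqI:
  fixes x y :: "'a::euclidean_space"
  assumes y: "y \<in> S" and orth: "\<And>s. s \<in> S \<Longrightarrow> (x - y) \<bullet> (s - y) = 0"
  shows "closest_point S x = y"
proof -
  have pyth: "(dist x s)\<^sup>2 = (dist x y)\<^sup>2 + (dist y s)\<^sup>2" if "s \<in> S" for s
  proof -
    have "(dist x s)\<^sup>2 = (norm ((x - y) - (s - y)))\<^sup>2" by (simp add: dist_norm)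
    also have "\<dots> = (norm (x - y))\<^sup>2 + (norm (s - y))\<^sup>2"
      using orth[OF that] by (simp add: power2_norm_eq_inner inner_diff inner_commute)
    finally show ?thesis by (simp add: dist_norm norm_minus_commute)
  qed
  show ?thesis unfolding closest_point_def
  proof (rule some_equality)
    show "y \<in> S \<and> (\<forall>s\<in>S. dist x y \<le> dist x s)"
    proof (intro conjI ballI y)
      fix s assume "s \<in> S"
      then have "(dist x y)\<^sup>2 \<le> (dist x s)\<^sup>2" by (simp add: pyth)
      then show "dist x y \<le> dist x s" by (rule power2_le_imp_le) simp
    qed
  next
    fix s assume s: "s \<in> S \<and> (\<forall>r\<in>S. dist x s \<le> dist x r)"
    then have "(dist x s)\<^sup>2 \<le> (dist x y)\<^sup>2" using y by (intro power_mono) auto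
    then have "(dist y s)\<^sup>2 \<le> 0" using pyth[of s] s by linarith
    then show "s = y" by simp
  qed
qed

lemma line_through_centred:
  "line_through (M + t) (M - t) = {M + a *\<^sub>R t | a. True}"
  unfolding line_through_def affine_hull_2
proof safe
  fix r s :: real assume "r + s = 1"
  then have r: "r = 1 - s" by simp
  have "r *\<^sub>R (M + t) + s *\<^sub>R (M - t) = M + (r - s) *\<^sub>R t"
    by (simp add: r vec_eq_iff algebra_simps)
  then show "\<exists>a. r *\<^sub>R (M + t) + s *\<^sub>R (M - t) = M + a *\<^sub>R t \<and> True" by blast
next
  fix a :: real
  have "M + a *\<^sub>R t = ((1 + a) / 2) *\<^sub>R (M + t) + ((1 - a) / 2) *\<^sub>R (M - t)"
    by (simp add: vec_eq_iff field_simps)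
  moreover have "(1 + a) / 2 + (1 - a) / 2 = 1" by (simp add: field_simps)
  ultimately show "\<exists>r s. M + a *\<^sub>R t = r *\<^sub>R (M + t) + s *\<^sub>R (M - t) \<and> r + s = 1" by blast
qed

lemma plane_through_centred:
  "plane_through (M + t) (M - t) (M + k *\<^sub>R t + d) = {M + a *\<^sub>R t + b *\<^sub>R d | a b. True}"
  unfolding plane_through_def affine_hull_3
proof safe
  fix r s q :: real assume "r + s + q = 1"
  then have r: "r = 1 - s - q" by simp
  have "r *\<^sub>R (M + t) + s *\<^sub>R (M - t) + q *\<^sub>R (M + k *\<^sub>R t + d)
      = M + (r - s + q * k) *\<^sub>R t + q *\<^sub>R d"
    unfolding r by (simp add: vec_eq_iff algebra_simps)
  then show "\<exists>a b. r *\<^sub>R (M + t) + s *\<^sub>R (M - t) + q *\<^sub>R (M + k *\<^sub>R t + d)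
      = M + a *\<^sub>R t + b *\<^sub>R d \<and> True" by blast
next
  fix a b :: real
  have "M + a *\<^sub>R t + b *\<^sub>R d = ((1 - b + a - b * k) / 2) *\<^sub>R (M + t)
      + ((1 - b - a + b * k) / 2) *\<^sub>R (M - t) + b *\<^sub>R (M + k *\<^sub>R t + d)"
    by (simp add: vec_eq_iff field_simps)
  moreover have "(1 - b + a - b * k) / 2 + (1 - b - a + b * k) / 2 + b = 1"
    by (simp add: field_simps)
  ultimately show "\<exists>r s q. M + a *\<^sub>R t + b *\<^sub>R d
      = r *\<^sub>R (M + t) + s *\<^sub>R (M - t) + q *\<^sub>R (M + k *\<^sub>R t + d) \<and> r + s + q = 1" by blast
qed

lemma reflect_in_line:
  assumes "orthogonal_frame u v w"
  shows "reflect_in (line_through (M + u) (M - u)) (M + x *\<^sub>R u + y *\<^sub>R v + z *\<^sub>R w)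
       = M + x *\<^sub>R u - y *\<^sub>R v - z *\<^sub>R w"
proof -
  have "closest_point (line_through (M + u) (M - u)) (M + x *\<^sub>R u + y *\<^sub>R v + z *\<^sub>R w)
      = M + x *\<^sub>R u"
    using assms unfolding line_through_centred orthogonal_frame_def
    by (intro closest_point_eqI) (auto simp: inner_add inner_diff inner_commute)
  then show ?thesis by (simp add: reflect_in_def scaleR_2)
qed

lemma reflect_in_plane:
  assumes "orthogonal_frame t u n"
  shows "reflect_in {M + a *\<^sub>R t + b *\<^sub>R u | a b. True} (M + x *\<^sub>R t + y *\<^sub>R u + z *\<^sub>R n)
       = M + x *\<^sub>R t + y *\<^sub>R u - z *\<^sub>R n"
proof -
  have "closest_point {M + a *\<^sub>R t + b *\<^sub>R u | a b. True} (M + x *\<^sub>R t + y *\<^sub>R u + z *\<^sub>R n)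
      = M + x *\<^sub>R t + y *\<^sub>R u"
    using assms unfolding orthogonal_frame_def
    by (intro closest_point_eqI) (auto simp: inner_add inner_diff inner_commute)
  then show ?thesis by (simp add: reflect_in_def scaleR_2)
qed

section \<open>Isogonality at an edge\<close>

text \<open>If \<open>t\<close> is parallel to the edge, \<open>u\<close> to the bisector plane and \<open>n\<close> is normal to it, then
  a plane through the edge is given by the ratio of the \<open>u\<close>- and \<open>n\<close>-coordinates of its points,
  and the reflection changes the sign of the \<open>n\<close>-coordinate.\<close>

lemma isogonal_at_iff_frame:
  assumes fr: "orthogonal_frame t u n"
    and bis: "bisector_plane (M + t) (M - t) C D = {M + a *\<^sub>R t + b *\<^sub>R u | a b. True}"
    and P: "P = M + x *\<^sub>R t + y *\<^sub>R u + z *\<^sub>R n"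
    and Q: "Q = M + x' *\<^sub>R t + y' *\<^sub>R u + z' *\<^sub>R n"
  shows "isogonal_at (M + t) (M - t) C D P Q \<longleftrightarrow> y * z' + z * y' = 0"
proof -
  have on_edge: "M + a *\<^sub>R t + b *\<^sub>R u + c *\<^sub>R n \<in> line_through (M + t) (M - t) \<longleftrightarrow> b = 0 \<and> c = 0"
    for a b c
  proof
    assume "M + a *\<^sub>R t + b *\<^sub>R u + c *\<^sub>R n \<in> line_through (M + t) (M - t)"
    then obtain r where "a *\<^sub>R t + b *\<^sub>R u + c *\<^sub>R n = r *\<^sub>R t + 0 *\<^sub>R u + 0 *\<^sub>R n"
      unfolding line_through_centred by (auto simp: algebra_simps)
    then show "b = 0 \<and> c = 0" using orthogonal_frame_coordinates_eq[OF fr] by blast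
  qed (auto simp: line_through_centred)
  have plane: "plane_through (M + t) (M - t) (M + a *\<^sub>R t + b *\<^sub>R u + c *\<^sub>R n)
      = {M + r *\<^sub>R t + (s * b) *\<^sub>R u + (s * c) *\<^sub>R n | r s. True}" for a b c
    using plane_through_centred[of M t a "b *\<^sub>R u + c *\<^sub>R n"]
    by (simp add: algebra_simps)
  have image: "reflect_in (bisector_plane (M + t) (M - t) C D) ` plane_through (M + t) (M - t) P
      = {M + r *\<^sub>R t + (s * y) *\<^sub>R u - (s * z) *\<^sub>R n | r s. True}"
    (is "_ = ?R")
  proof -
    have refl: "reflect_in {M + a *\<^sub>R t + b *\<^sub>R u | a b. True} (M + r *\<^sub>R t + (s * y) *\<^sub>R u + (s * z) *\<^sub>R n)
        = M + r *\<^sub>R t + (s * y) *\<^sub>R u - (s * z) *\<^sub>R n" for r s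
      by (rule reflect_in_plane[OF fr])
    show ?thesis
      unfolding P plane bis
    proof (intro set_eqI iffI)
      fix X assume "X \<in> ?R"
      then obtain r s where "X = M + r *\<^sub>R t + (s * y) *\<^sub>R u - (s * z) *\<^sub>R n" by blast
      then have "X = reflect_in {M + a *\<^sub>R t + b *\<^sub>R u | a b. True} (M + r *\<^sub>R t + (s * y) *\<^sub>R u + (s * z) *\<^sub>R n)"
        by (simp only: refl)
      then show "X \<in> reflect_in {M + a *\<^sub>R t + b *\<^sub>R u | a b. True} `
          {M + r *\<^sub>R t + (s * y) *\<^sub>R u + (s * z) *\<^sub>R n | r s. True}" by (rule image_eqI) blast
    qed (use refl in blast)
  qed
  have planeQ: "plane_through (M + t) (M - t) Q
      = {M + r *\<^sub>R t + (s * y') *\<^sub>R u + (s * z') *\<^sub>R n | r s. True}" (is "_ = ?Q")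
    unfolding Q plane ..
  show ?thesis
  proof (cases "(y = 0 \<and> z = 0) \<or> (y' = 0 \<and> z' = 0)")
    case True
    then show ?thesis unfolding isogonal_at_def P Q on_edge by auto
  next
    case False
    have "?R = ?Q \<longleftrightarrow> y * z' + z * y' = 0"
    proof
      assume "?R = ?Q"
      moreover have "M + 0 *\<^sub>R t + (1 * y') *\<^sub>R u + (1 * z') *\<^sub>R n \<in> ?Q" by blast
      ultimately obtain r s where
        "M + 0 *\<^sub>R t + (1 * y') *\<^sub>R u + (1 * z') *\<^sub>R n = M + r *\<^sub>R t + (s * y) *\<^sub>R u - (s * z) *\<^sub>R n"
        by blast
      then have "0 *\<^sub>R t + y' *\<^sub>R u + z' *\<^sub>R n = r *\<^sub>R t + (s * y) *\<^sub>R u + (- (s * z)) *\<^sub>R n"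
        by (simp add: algebra_simps)
      then have "y' = s * y \<and> z' = - (s * z)"
        using orthogonal_frame_coordinates_eq[OF fr] by blast
      then show "y * z' + z * y' = 0" by simp
    next
      assume eq: "y * z' + z * y' = 0"
      obtain k where k: "k \<noteq> 0" "y' = k * y" "z' = - (k * z)"
      proof (cases "y = 0")
        case True
        then have "z \<noteq> 0" "y' = 0" using False eq by auto
        then show thesis using that[of "- z' / z"] False True by auto
      next
        case y: False
        then have z': "z' = - (z * y' / y)" using eq by (simp add: field_simps)
        then have "y' \<noteq> 0" using False by auto
        then show thesis using that[of "y' / y"] y z' by auto
      qed
      show "?R = ?Q"
      proof (intro set_eqI iffI)
        fix X assume "X \<in> ?R"
        then obtain r s where "X = M + r *\<^sub>R t + (s * y) *\<^sub>R u - (s * z) *\<^sub>R n" by blast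
        then have "X = M + r *\<^sub>R t + (s / k * y') *\<^sub>R u + (s / k * z') *\<^sub>R n"
          using k by simp
        then show "X \<in> ?Q" by blast
      next
        fix X assume "X \<in> ?Q"
        then obtain r s where "X = M + r *\<^sub>R t + (s * y') *\<^sub>R u + (s * z') *\<^sub>R n" by blast
        then have "X = M + r *\<^sub>R t + (s * k * y) *\<^sub>R u - (s * k * z) *\<^sub>R n"
          using k by (simp add: mult.assoc)
        then show "X \<in> ?R" by blast
      qed
    qed
    moreover have "P \<notin> line_through (M + t) (M - t)" "Q \<notin> line_through (M + t) (M - t)"
      using False unfolding P Q on_edge by simp_all
    ultimately show ?thesis
      unfolding isogonal_at_def image planeQ by (simp only: simp_thms)
  qed
qed

text \<open>In the plane orthogonal to the edge, the two other vertices project to mirror images: both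
  have the component \<open>- 2 u\<close>, and opposite components along \<open>n\<close>.  The unit vectors in these
  directions therefore add up to a negative multiple of \<open>u\<close>.\<close>

lemma bisector_plane_box:
  fixes O' u v w :: "real^3"
  assumes fr: "orthogonal_frame u v w"
  defines "M \<equiv> O' + u" and "t \<equiv> v + w"
  shows "bisector_plane (M + t) (M - t) (O' - u + v - w) (O' - u - v + w)
       = {M + a *\<^sub>R t + b *\<^sub>R u | a b. True}"
proof -
  \<comment> \<open>These weights make \<open>n\<close> orthogonal to \<open>t\<close> within the plane of \<open>v\<close> and \<open>w\<close>.\<close>
  define n where "n = (w \<bullet> w) *\<^sub>R v - (v \<bullet> v) *\<^sub>R w"
  define h where "h = v \<bullet> v + w \<bullet> w"
  have nz: "u \<noteq> 0" "v \<noteq> 0" "w \<noteq> 0" and orth: "u \<bullet> v = 0" "u \<bullet> w = 0" "v \<bullet> w = 0"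
    using fr by (auto simp: orthogonal_frame_def)
  have h: "h > 0" using nz unfolding h_def by (simp add: add_pos_pos)
  have tn: "t \<bullet> n = 0" "t \<bullet> u = 0" "u \<bullet> n = 0"
    using orth by (auto simp: t_def n_def inner_add inner_diff inner_commute)
  define k where "k = (v \<bullet> v - w \<bullet> w) / h"
  have vw: "v - w = k *\<^sub>R t + (2 / h) *\<^sub>R n"
  proof -
    have "h *\<^sub>R (v - w) = (v \<bullet> v - w \<bullet> w) *\<^sub>R t + 2 *\<^sub>R n"
      by (simp add: h_def t_def n_def vec_eq_iff algebra_simps)
    then have "(1 / h) *\<^sub>R (h *\<^sub>R (v - w)) = (1 / h) *\<^sub>R ((v \<bullet> v - w \<bullet> w) *\<^sub>R t + 2 *\<^sub>R n)" by simp
    then show ?thesis using h by (simp add: k_def scaleR_add_right)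
  qed
  have foot: "closest_point (line_through (M + t) (M - t)) (M + c *\<^sub>R t + d) = M + c *\<^sub>R t"
    if "t \<bullet> d = 0" for c d
    unfolding line_through_centred
    using that by (intro closest_point_eqI) (auto simp: inner_add inner_diff inner_commute)
  have C: "O' - u + v - w = M + k *\<^sub>R t + (- 2 *\<^sub>R u + (2 / h) *\<^sub>R n)"
    using vw unfolding M_def by (simp add: algebra_simps scaleR_2)
  have D: "O' - u - v + w = M + (- k) *\<^sub>R t + (- 2 *\<^sub>R u - (2 / h) *\<^sub>R n)"
    using vw unfolding M_def by (simp add: algebra_simps scaleR_2)
  define N where "N = norm (- 2 *\<^sub>R u + (2 / h) *\<^sub>R n)"
  have N': "norm (- 2 *\<^sub>R u - (2 / h) *\<^sub>R n) = N"
    unfolding N_def norm_eq using tn by (simp add: inner_add inner_diff inner_commute)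
  have "(- 2 *\<^sub>R u + (2 / h) *\<^sub>R n) \<bullet> u \<noteq> 0"
    using tn nz by (simp add: inner_add inner_diff inner_commute)
  then have N: "N \<noteq> 0" unfolding N_def by auto
  have fC: "face_direction (M + t) (M - t) (O' - u + v - w)
      = (1 / N) *\<^sub>R (- 2 *\<^sub>R u + (2 / h) *\<^sub>R n)"
  proof -
    have "t \<bullet> (- 2 *\<^sub>R u + (2 / h) *\<^sub>R n) = 0" using tn by (simp add: inner_add inner_diff)
    from foot[OF this, of k] show ?thesis
      unfolding face_direction_def C by (simp add: sgn_div_norm N_def divide_inverse)
  qed
  have fD: "face_direction (M + t) (M - t) (O' - u - v + w)
      = (1 / N) *\<^sub>R (- 2 *\<^sub>R u - (2 / h) *\<^sub>R n)"
  proof -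
    have "t \<bullet> (- 2 *\<^sub>R u - (2 / h) *\<^sub>R n) = 0" using tn by (simp add: inner_add inner_diff)
    from foot[OF this, of "- k"] N' show ?thesis
      unfolding face_direction_def D by (simp add: sgn_div_norm divide_inverse)
  qed
  have sum: "M + t + face_direction (M + t) (M - t) (O' - u + v - w)
        + face_direction (M + t) (M - t) (O' - u - v + w) = M + 1 *\<^sub>R t + (- 4 / N) *\<^sub>R u"
    unfolding fC fD by (simp add: vec_eq_iff field_simps)
  have "{M + a *\<^sub>R t + b *\<^sub>R ((- 4 / N) *\<^sub>R u) | a b. True} = {M + a *\<^sub>R t + b *\<^sub>R u | a b. True}"
  proof (intro set_eqI iffI)
    fix X assume "X \<in> {M + a *\<^sub>R t + b *\<^sub>R u | a b. True}"
    then obtain a b where "X = M + a *\<^sub>R t + b *\<^sub>R u" by blast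
    then have "X = M + a *\<^sub>R t + (b * (- N / 4)) *\<^sub>R ((- 4 / N) *\<^sub>R u)" using N by simp
    then show "X \<in> {M + a *\<^sub>R t + b *\<^sub>R ((- 4 / N) *\<^sub>R u) | a b. True}" by blast
  next
    fix X assume "X \<in> {M + a *\<^sub>R t + b *\<^sub>R ((- 4 / N) *\<^sub>R u) | a b. True}"
    then obtain a b where "X = M + a *\<^sub>R t + (b * (- 4 / N)) *\<^sub>R u" by auto
    then show "X \<in> {M + a *\<^sub>R t + b *\<^sub>R u | a b. True}" by blast
  qed
  then show ?thesis
    unfolding bisector_plane_def sum plane_through_centred .
qed

text \<open>In the frame of the edge, with origin at its midpoint \<open>O' + u\<close>, a point with box
  coordinates \<open>(x, y, z)\<close> has \<open>u\<close>-coordinate \<open>x - 1\<close>, and its coordinate along the normal of the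
  bisector plane is proportional to \<open>y - z\<close>.\<close>

lemma isogonal_at_box_iff:
  fixes O' u v w :: "real^3"
  assumes fr: "orthogonal_frame u v w"
  shows "isogonal_at (O' + u + v + w) (O' + u - v - w) (O' - u + v - w) (O' - u - v + w)
           (O' + x *\<^sub>R u + y *\<^sub>R v + z *\<^sub>R w) (O' + x' *\<^sub>R u + y' *\<^sub>R v + z' *\<^sub>R w)
       \<longleftrightarrow> (1 - x) * (y' - z') + (1 - x') * (y - z) = 0"
proof -
  define M where "M = O' + u"
  define t where "t = v + w"
  \<comment> \<open>These weights make \<open>n\<close> orthogonal to \<open>t\<close> within the plane of \<open>v\<close> and \<open>w\<close>.\<close>
  define n where "n = (w \<bullet> w) *\<^sub>R v - (v \<bullet> v) *\<^sub>R w"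
  define h where "h = v \<bullet> v + w \<bullet> w"
  have nz: "u \<noteq> 0" "v \<noteq> 0" "w \<noteq> 0" and orth: "u \<bullet> v = 0" "u \<bullet> w = 0" "v \<bullet> w = 0"
    using fr by (auto simp: orthogonal_frame_def)
  have h: "h > 0" using nz unfolding h_def by (simp add: add_pos_pos)
  have "t \<bullet> v \<noteq> 0" "n \<bullet> v \<noteq> 0"
    using nz orth by (auto simp: t_def n_def inner_add inner_diff inner_commute)
  then have "t \<noteq> 0" "n \<noteq> 0" by auto
  moreover have "t \<bullet> u = 0" "t \<bullet> n = 0" "u \<bullet> n = 0"
    using orth by (auto simp: t_def n_def inner_add inner_diff inner_commute)
  ultimately have fr': "orthogonal_frame t u n"
    using nz unfolding orthogonal_frame_def by simp
  have coords: "O' + a *\<^sub>R u + b *\<^sub>R v + c *\<^sub>R w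
      = M + ((b * (v \<bullet> v) + c * (w \<bullet> w)) / h) *\<^sub>R t + (a - 1) *\<^sub>R u + ((b - c) / h) *\<^sub>R n" for a b c
  proof -
    have "h *\<^sub>R (b *\<^sub>R v + c *\<^sub>R w) = (b * (v \<bullet> v) + c * (w \<bullet> w)) *\<^sub>R t + (b - c) *\<^sub>R n"
      by (simp add: h_def t_def n_def algebra_simps)
    then have "(1 / h) *\<^sub>R (h *\<^sub>R (b *\<^sub>R v + c *\<^sub>R w))
        = (1 / h) *\<^sub>R ((b * (v \<bullet> v) + c * (w \<bullet> w)) *\<^sub>R t + (b - c) *\<^sub>R n)" by simp
    then have "b *\<^sub>R v + c *\<^sub>R w
        = ((b * (v \<bullet> v) + c * (w \<bullet> w)) / h) *\<^sub>R t + ((b - c) / h) *\<^sub>R n"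
      using h by (simp add: scaleR_add_right)
    then show ?thesis unfolding M_def by (simp add: algebra_simps)
  qed
  have AB: "O' + u + v + w = M + t" "O' + u - v - w = M - t"
    by (simp_all add: M_def t_def algebra_simps)
  have "isogonal_at (M + t) (M - t) (O' - u + v - w) (O' - u - v + w)
           (O' + x *\<^sub>R u + y *\<^sub>R v + z *\<^sub>R w) (O' + x' *\<^sub>R u + y' *\<^sub>R v + z' *\<^sub>R w)
       \<longleftrightarrow> (x - 1) * ((y' - z') / h) + ((y - z) / h) * (x' - 1) = 0"
    using isogonal_at_iff_frame[OF fr' _ coords coords]
      bisector_plane_box[OF fr, of O'] unfolding M_def t_def by blast
  also have "(x - 1) * ((y' - z') / h) + ((y - z) / h) * (x' - 1)
      = - ((1 - x) * (y' - z') + (1 - x') * (y - z)) / h"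
    using h by (simp add: field_simps)
  finally show ?thesis unfolding AB using h by (simp add: neg_eq_iff_add_eq_0)
qed

section \<open>Isogonal conjugates in an isosceles tetrahedron\<close>

text \<open>The pattern of signs of the vertices is preserved by every permutation of the axes
  and by reversing two of them.  These symmetries of the box act transitively on the edges, so the
  criterion at one edge gives all six.\<close>

lemma isogonal_conjugates_box_iff:
  fixes O' u v w :: "real^3"
  assumes fr: "orthogonal_frame u v w"
  shows "isogonal_conjugates (O' + u + v + w) (O' + u - v - w) (O' - u + v - w) (O' - u - v + w)
           (O' + x *\<^sub>R u + y *\<^sub>R v + z *\<^sub>R w) (O' + x' *\<^sub>R u + y' *\<^sub>R v + z' *\<^sub>R w)
       \<longleftrightarrow> (1 - x) * (y' - z') + (1 - x') * (y - z) = 0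
         \<and> (1 - y) * (x' - z') + (1 - y') * (x - z) = 0
         \<and> (1 - z) * (x' - y') + (1 - z') * (x - y) = 0
         \<and> (1 + z) * (x' + y') + (1 + z') * (x + y) = 0
         \<and> (1 + y) * (x' + z') + (1 + y') * (x + z) = 0
         \<and> (1 + x) * (y' + z') + (1 + x') * (y + z) = 0"
    (is "isogonal_conjugates ?A ?B ?C ?D ?P ?Q \<longleftrightarrow> _")
proof -
  note swap = orthogonal_frame_swap12[OF fr] and rot = orthogonal_frame_rotate[OF fr]
  have AB: "isogonal_at ?A ?B ?C ?D ?P ?Q \<longleftrightarrow> (1 - x) * (y' - z') + (1 - x') * (y - z) = 0"
    by (rule isogonal_at_box_iff[OF fr])
  have AC: "isogonal_at ?A ?C ?B ?D ?P ?Q \<longleftrightarrow> (1 - y) * (x' - z') + (1 - y') * (x - z) = 0"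
    using isogonal_at_box_iff[OF swap, of O' y x z y' x' z'] by (simp add: algebra_simps)
  have AD: "isogonal_at ?A ?D ?B ?C ?P ?Q \<longleftrightarrow> (1 - z) * (x' - y') + (1 - z') * (x - y) = 0"
    using isogonal_at_box_iff[OF rot, of O' z x y z' x' y'] by (simp add: algebra_simps)
  have BC: "isogonal_at ?B ?C ?A ?D ?P ?Q \<longleftrightarrow> (1 + z) * (x' + y') + (1 + z') * (x + y) = 0"
    using isogonal_at_box_iff[OF orthogonal_frame_minus13[OF rot], of O' "- z" x "- y" "- z'" x' "- y'"]
    by (simp add: algebra_simps)
  have BD: "isogonal_at ?B ?D ?A ?C ?P ?Q \<longleftrightarrow> (1 + y) * (x' + z') + (1 + y') * (x + z) = 0"
    using isogonal_at_box_iff[OF orthogonal_frame_minus13[OF swap], of O' "- y" x "- z" "- y'" x' "- z'"]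
    by (simp add: algebra_simps)
  have CD: "isogonal_at ?C ?D ?A ?B ?P ?Q \<longleftrightarrow> (1 + x) * (y' + z') + (1 + x') * (y + z) = 0"
    using isogonal_at_box_iff[OF orthogonal_frame_minus13[OF fr], of O' "- x" y "- z" "- x'" y' "- z'"]
    by (simp add: algebra_simps)
  show ?thesis unfolding isogonal_conjugates_def AB AC AD BC BD CD ..
qed

theorem theorem5p1:
  fixes A B C D :: "real^3" and l :: "(real^3) set"
  assumes "isosceles_tetrahedron A B C D"
    and "l \<in> bimedians A B C D"
  shows "hyperbolic_paraboloid {P. isogonal_conjugates A B C D P (reflect_in l P)}"
proof -
  obtain O' u v w where fr: "orthogonal_frame u v w"
    and verts: "A = O' + u + v + w" "B = O' + u - v - w" "C = O' - u + v - w" "D = O' - u - v + w"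
    using isosceles_tetrahedron_in_box[OF assms(1)] .
  have mids: "midpoint A B = O' + u" "midpoint C D = O' - u" "midpoint A C = O' + v"
    "midpoint B D = O' - v" "midpoint A D = O' + w" "midpoint B C = O' - w"
    by (simp_all add: verts midpoint_def vec_eq_iff)
  note swap = orthogonal_frame_swap12[OF fr] and rot = orthogonal_frame_rotate[OF fr]
  consider "l = line_through (O' + u) (O' - u)" | "l = line_through (O' + v) (O' - v)"
    | "l = line_through (O' + w) (O' - w)"
    using assms(2) unfolding bimedians_def mids by blast
  then show ?thesis
  proof cases
    case 1
    have refl: "reflect_in l (O' + x *\<^sub>R u + y *\<^sub>R v + z *\<^sub>R w)
        = O' + x *\<^sub>R u + (- y) *\<^sub>R v + (- z) *\<^sub>R w" for x y z
      unfolding 1 reflect_in_line[OF fr] by simp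
    show ?thesis
    proof (rule hyperbolic_paraboloid_coordinatesI[OF fr])
      fix x y z
      show "O' + x *\<^sub>R u + y *\<^sub>R v + z *\<^sub>R w \<in> {P. isogonal_conjugates A B C D P (reflect_in l P)}
          \<longleftrightarrow> x = y * z"
        unfolding mem_Collect_eq refl verts isogonal_conjugates_box_iff[OF fr]
        by (auto simp: algebra_simps)
    qed
  next
    case 2
    have perm: "O' + y *\<^sub>R v + x *\<^sub>R u + z *\<^sub>R w = O' + x *\<^sub>R u + y *\<^sub>R v + z *\<^sub>R w" for x y z
      by (simp add: algebra_simps)
    have refl: "reflect_in l (O' + x *\<^sub>R u + y *\<^sub>R v + z *\<^sub>R w)
        = O' + (- x) *\<^sub>R u + y *\<^sub>R v + (- z) *\<^sub>R w" for x y z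
      using reflect_in_line[OF swap, of O' y x z] unfolding 2 perm by simp
    show ?thesis
    proof (rule hyperbolic_paraboloid_coordinatesI[OF swap])
      fix y x z
      show "O' + y *\<^sub>R v + x *\<^sub>R u + z *\<^sub>R w \<in> {P. isogonal_conjugates A B C D P (reflect_in l P)}
          \<longleftrightarrow> y = x * z"
        unfolding mem_Collect_eq perm refl verts isogonal_conjugates_box_iff[OF fr]
        by (auto simp: algebra_simps)
    qed
  next
    case 3
    have perm: "O' + z *\<^sub>R w + x *\<^sub>R u + y *\<^sub>R v = O' + x *\<^sub>R u + y *\<^sub>R v + z *\<^sub>R w" for x y z
      by (simp add: algebra_simps)
    have refl: "reflect_in l (O' + x *\<^sub>R u + y *\<^sub>R v + z *\<^sub>R w)
        = O' + (- x) *\<^sub>R u + (- y) *\<^sub>R v + z *\<^sub>R w" for x y z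
      using reflect_in_line[OF rot, of O' z x y] unfolding 3 perm by simp
    show ?thesis
    proof (rule hyperbolic_paraboloid_coordinatesI[OF rot])
      fix z x y
      show "O' + z *\<^sub>R w + x *\<^sub>R u + y *\<^sub>R v \<in> {P. isogonal_conjugates A B C D P (reflect_in l P)}
          \<longleftrightarrow> z = x * y"
        unfolding mem_Collect_eq perm refl verts isogonal_conjugates_box_iff[OF fr]
        by (auto simp: algebra_simps)
    qed
  qed
qed

end
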